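(* Let $D$ be a weighted naturally oriented even cycle with underlying graph $C_4=(x_1,x_2,x_3,x_4)$, and suppose at least one vertex of $D$ has non-trivial weight. Then $I(D)^{(s)}=I(D)^s$ for all $s\ge2$ if and only if $D$ satisfies one of the following conditions: (1) all vertices of $D$ have non-trivial weights; (2) exactly one vertex of $D$ has non-trivial weight; (3) exactly two vertices of $D$ have non-trivial weights and these two vertices are non-consecutive on the cycle.
   Context: Let $k$ be a field. A weighted oriented graph $D=(V(D),E(D),w)$ has a finite vertex set $V(D)$, a set $E(D)$ of ordered pairs of distinct vertices ($(x,y)\in E(D)$ is a directed edge from $x$ to $y$), each edge $\{x,y\}$ of the underlying simple graph $G$ carrying exactly one orientation, and a weight function $w:V(D)\to\mathbb N=\{1,2,\dots\}$. A vertex is a source if it has only outgoing edges; convention: sources have weight $1$. A weight is non-trivial if it is $\ne1$. The edge ideal of $D$ is $I(D)=(x\,y^{w(y)} : (x,y)\in E(D))$ in the polynomial ring $R$ over $k$ whose variables are the vertices of $D$. For $s\ge1$ the $s$-th symbolic power of an ideal $I$ is $I^{(s)}=\bigcap_{P\in\operatorname{Ass}(I)}(I^sR_P\cap R)$, where $\operatorname{Ass}(I)$ is the set of associated primes of $R/I$. A cycle is naturally oriented if all its edges are oriented in the clockwise direction (i.e. it is a directed cycle). *)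

theory Defs
  imports
    Complex_Main
    "HOL-Library.Poly_Mapping"
    "HOL-Computational_Algebra.Fraction_Field"
begin

section \<open>Ideals and symbolic powers\<close>

text \<open>Ideals of a commutative ring are its submodules as a module over itself.\<close>

global_interpretation ideal: module "(*) :: 'a::comm_ring_1 \<Rightarrow> 'a \<Rightarrow> 'a"
  defines ideal_gen = ideal.span
    and is_ideal = ideal.subspace
  by unfold_locales (simp_all add: algebra_simps)

definition is_prime_ideal :: "'a::comm_ring_1 set \<Rightarrow> bool" where
  "is_prime_ideal P \<longleftrightarrow>
     is_ideal P \<and> P \<noteq> UNIV \<and> (\<forall>a b. a * b \<in> P \<longrightarrow> a \<in> P \<or> b \<in> P)"

definition ideal_power :: "'a::comm_ring_1 set \<Rightarrow> nat \<Rightarrow> 'a set" where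
  "ideal_power I s = ideal_gen {\<Prod>i<s. f i | f. \<forall>i<s. f i \<in> I}"

text \<open>The associated primes of \<open>R/I\<close>: the set \<open>{r. r * f \<in> I}\<close> is the annihilator in \<open>R\<close> of
  the residue class of \<open>f\<close> in \<open>R/I\<close>.\<close>

definition associated_primes :: "'a::comm_ring_1 set \<Rightarrow> 'a set set" where
  "associated_primes I = {P. is_prime_ideal P \<and> (\<exists>f. P = {r. r * f \<in> I})}"

text \<open>For a domain \<open>R\<close>, the localization \<open>R\<^sub>P\<close> is realised inside the field of fractions of \<open>R\<close>,
  with \<open>a \<in> R\<close> identified with \<open>Fract a 1\<close>. The definitions are meant for a prime ideal \<open>P\<close>,
  so that denominators outside \<open>P\<close> are nonzero.\<close>

definition localization :: "'a::idom set \<Rightarrow> 'a fract set" where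
  "localization P = {Fract a u | a u. u \<notin> P}"

definition extended_ideal :: "'a::idom set \<Rightarrow> 'a set \<Rightarrow> 'a fract set" where
  "extended_ideal P J =
     {\<Sum>i<n. c i * Fract (a i) 1 | (n::nat) c a. \<forall>i<n. c i \<in> localization P \<and> a i \<in> J}"

definition contracted_ideal :: "'a::idom fract set \<Rightarrow> 'a set" where
  "contracted_ideal K = {f. Fract f 1 \<in> K}"

definition symbolic_power :: "'a::idom set \<Rightarrow> nat \<Rightarrow> 'a set" where
  "symbolic_power I s =
     (\<Inter>P \<in> associated_primes I. contracted_ideal (extended_ideal P (ideal_power I s)))"


section \<open>Weighted oriented graphs\<close>

text \<open>The vertex set \<open>V(D)\<close> is the whole finite type \<open>'v\<close>. Membership of \<open>(x, y)\<close> in \<open>E\<close> means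
  that there is an edge directed from \<open>x\<close> to \<open>y\<close>.\<close>

definition is_source :: "('v \<times> 'v) set \<Rightarrow> 'v \<Rightarrow> bool" where
  "is_source E x \<longleftrightarrow> (\<forall>y. (y, x) \<notin> E)"

locale weighted_oriented_graph =
  fixes E :: "('v::finite \<times> 'v) set" and w :: "'v \<Rightarrow> nat"
  assumes no_loop: "(x, x) \<notin> E"
    and oriented: "(x, y) \<in> E \<Longrightarrow> (y, x) \<notin> E"
    and weight_pos: "w x \<ge> 1"
    and source_weight: "is_source E x \<Longrightarrow> w x = 1"

definition nontrivial_vertices :: "('v \<Rightarrow> nat) \<Rightarrow> 'v set" where
  "nontrivial_vertices w = {v. w v \<noteq> 1}"

definition naturally_oriented_cycle :: "('v \<times> 'v) set \<Rightarrow> 'v list \<Rightarrow> bool" where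
  "naturally_oriented_cycle E xs \<longleftrightarrow>
     length xs \<ge> 3 \<and> distinct xs \<and> set xs = UNIV \<and>
     E = {(xs ! i, xs ! (Suc i mod length xs)) | i. i < length xs}"

text \<open>\<open>('v, 'k) mpoly\<close> is the polynomial ring over \<open>'k\<close> whose variables are the elements
  of \<open>'v\<close>: finitely supported coefficient functions on the exponent vectors \<open>'v \<Rightarrow>\<^sub>0 nat\<close>.
  A linear order on \<open>'v\<close> is needed only because the library's instance of class \<open>idom\<close> for this
  type uses the induced lexicographic order on exponent vectors; no definition refers to it.\<close>

type_synonym ('v, 'k) mpoly = "('v \<Rightarrow>\<^sub>0 nat) \<Rightarrow>\<^sub>0 'k"

definition var :: "'v \<Rightarrow> ('v, 'k::field) mpoly" where
  "var v = Poly_Mapping.single (Poly_Mapping.single v 1) 1"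

definition edge_ideal ::
    "('v \<times> 'v) set \<Rightarrow> ('v \<Rightarrow> nat) \<Rightarrow> ('v, 'k::field) mpoly set" where
  "edge_ideal E w = ideal_gen {var x * var y ^ w y | x y. (x, y) \<in> E}"

end

theory Submission
  imports Defs
begin

text \<open>
  All ideals involved are monomial: \<open>I ^ s\<close> is spanned by the monomials \<open>m\<close> that dominate a product
  of \<open>s\<close> edge monomials, which is a system of four linear inequalities in the multiplicities
  \<open>n\<^sub>1, \<dots>, n\<^sub>4\<close> of the edges. Localizing at a prime generated by a set \<open>S\<close> of variables drops the
  inequalities for the vertices outside \<open>S\<close>.

  If all weights are non-trivial, the maximal ideal is associated to \<open>I\<close> and nothing is dropped.
  If \<open>w x\<^sub>2 = w x\<^sub>4 = 1\<close>, the annihilators modulo \<open>I\<close> of \<open>x\<^sub>1 ^ w x\<^sub>1 * x\<^sub>3 ^ w x\<^sub>3\<close>,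
  \<open>x\<^sub>2 * x\<^sub>3 ^ (w x\<^sub>3 - 1)\<close> and \<open>x\<^sub>4 * x\<^sub>1 ^ (w x\<^sub>1 - 1)\<close> are prime and give three partial systems, whose solvability
  implies that of the full one. Up to rotation the remaining case is \<open>w x\<^sub>1, w x\<^sub>2 \<ge> 2\<close> and
  \<open>w x\<^sub>4 = 1\<close>. There \<open>x\<^sub>1 * x\<^sub>2 ^ b * x\<^sub>3 ^ (b * c) * x\<^sub>4\<close> with \<open>b = w x\<^sub>2\<close> and \<open>c = w x\<^sub>3\<close> lies in the
  symbolic but not in the ordinary power of exponent \<open>b + 1\<close>.
\<close>

section \<open>Symbolic powers without fractions\<close>

lemma is_ideal_mult_left: "is_ideal J \<Longrightarrow> a \<in> J \<Longrightarrow> r * a \<in> J"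
  by (rule ideal.subspace_scale)

lemma is_prime_ideal_D:
  assumes "is_prime_ideal P"
  shows "0 \<in> P" "1 \<notin> P" "a \<notin> P \<Longrightarrow> b \<notin> P \<Longrightarrow> a * b \<notin> P"
proof -
  show "0 \<in> P"
    using assms ideal.subspace_0 unfolding is_prime_ideal_def by blast
  show "1 \<notin> P"
    using assms is_ideal_mult_left[of P 1] unfolding is_prime_ideal_def by auto
  show "a \<notin> P \<Longrightarrow> b \<notin> P \<Longrightarrow> a * b \<notin> P"
    using assms unfolding is_prime_ideal_def by blast
qed

lemma is_prime_ideal_power_notin:
  assumes "is_prime_ideal P" "a \<notin> P"
  shows "a ^ n \<notin> P"
  by (induction n) (use assms is_prime_ideal_D[OF assms(1)] in auto)

text \<open>The complement of a prime is multiplicatively closed and omits 0, so the terms can be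
  added one at a time over the product of their denominators.\<close>

lemma extended_ideal_common_denominator:
  fixes c :: "nat \<Rightarrow> 'a::idom fract"
  assumes P: "is_prime_ideal P" and J: "is_ideal J"
    and "\<forall>i<n. c i \<in> localization P \<and> a i \<in> J"
  shows "\<exists>b\<in>J. \<exists>u. u \<notin> P \<and> (\<Sum>i<n. c i * Fract (a i) 1) = Fract b u"
  using assms(3)
proof (induction n)
  case 0
  then show ?case
    using is_prime_ideal_D[OF P] ideal.subspace_0[OF J]
    by (auto simp: Zero_fract_def)
next
  case (Suc n)
  then obtain b u where bu: "b \<in> J" "u \<notin> P" "(\<Sum>i<n. c i * Fract (a i) 1) = Fract b u"
    by auto
  from Suc.prems obtain d v where dv: "c n = Fract d v" "v \<notin> P" and "a n \<in> J"
    by (auto simp: localization_def)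
  have nz: "u \<noteq> 0" "v \<noteq> 0"
    using bu dv is_prime_ideal_D[OF P] by auto
  have "(\<Sum>i<Suc n. c i * Fract (a i) 1) = Fract (v * b + (u * d) * a n) (u * v)"
  proof -
    have "(\<Sum>i<Suc n. c i * Fract (a i) 1) = Fract b u + Fract (d * a n) v"
      by (simp only: sum.lessThan_Suc bu(3) dv(1) mult_fract mult_1_right)
    also have "\<dots> = Fract (b * v + d * a n * u) (u * v)"
      by (rule add_fract[OF nz])
    also have "b * v + d * a n * u = v * b + (u * d) * a n"
      by (simp only: mult.commute mult.left_commute)
    finally show ?thesis .
  qed
  moreover have "v * b + (u * d) * a n \<in> J"
    by (intro ideal.subspace_add[OF J] is_ideal_mult_left[OF J] bu \<open>a n \<in> J\<close>)
  moreover have "u * v \<notin> P"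
    using bu dv is_prime_ideal_D[OF P] by auto
  ultimately show ?case
    by blast
qed

text \<open>Frees all later arguments from fractions: a common denominator \<open>u\<close> serves
  as the multiplier, and conversely \<open>f\<close> is \<open>1/u\<close> times
  \<open>u * f\<close>.\<close>

lemma contracted_extended_ideal_iff:
  assumes P: "is_prime_ideal P" and J: "is_ideal J"
  shows "f \<in> contracted_ideal (extended_ideal P J) \<longleftrightarrow> (\<exists>u. u \<notin> P \<and> u * f \<in> J)"
proof
  assume "f \<in> contracted_ideal (extended_ideal P J)"
  then obtain n :: nat and c a
    where "Fract f 1 = (\<Sum>i<n. c i * Fract (a i) 1)"
      "\<forall>i<n. c i \<in> localization P \<and> a i \<in> J"
    by (auto simp: contracted_ideal_def extended_ideal_def)
  then obtain b u where "b \<in> J" "u \<notin> P" "Fract f 1 = Fract b u"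
    using extended_ideal_common_denominator[OF P J] by metis
  moreover from this have "u * f = b"
    using is_prime_ideal_D(1)[OF P] eq_fract(1)[of 1 u f b] by (auto simp: mult.commute)
  ultimately show "\<exists>u. u \<notin> P \<and> u * f \<in> J"
    by auto
next
  assume "\<exists>u. u \<notin> P \<and> u * f \<in> J"
  then obtain u where u: "u \<notin> P" "u * f \<in> J"
    by auto
  have "u \<noteq> 0"
    using u is_prime_ideal_D[OF P] by auto
  then have "Fract f 1 = (\<Sum>i<1::nat. Fract 1 u * Fract (u * f) 1)"
    by (simp add: eq_fract)
  moreover have "Fract 1 u \<in> localization P"
    using u by (auto simp: localization_def)
  ultimately have "Fract f 1 \<in> extended_ideal P J"
    unfolding extended_ideal_def using u(2)
    by (intro CollectI exI[of _ "1::nat"] exI[of _ "\<lambda>_. Fract 1 u"] exI[of _ "\<lambda>_. u * f"]) simp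
  then show "f \<in> contracted_ideal (extended_ideal P J)"
    by (simp add: contracted_ideal_def)
qed

lemma is_ideal_ideal_power: "is_ideal (ideal_power I s)"
  unfolding ideal_power_def by (rule ideal.subspace_span)

lemma symbolic_power_iff:
  "f \<in> symbolic_power I s \<longleftrightarrow>
     (\<forall>P\<in>associated_primes I. \<exists>u. u \<notin> P \<and> u * f \<in> ideal_power I s)"
proof -
  have "f \<in> contracted_ideal (extended_ideal P (ideal_power I s)) \<longleftrightarrow>
      (\<exists>u. u \<notin> P \<and> u * f \<in> ideal_power I s)" if "P \<in> associated_primes I" for P
    using that contracted_extended_ideal_iff[OF _ is_ideal_ideal_power]
    unfolding associated_primes_def by blast
  then show ?thesis
    unfolding symbolic_power_def by blast
qed

lemma ideal_power_subset_symbolic_power: "ideal_power I s \<subseteq> symbolic_power I s"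
proof
  fix f assume "f \<in> ideal_power I s"
  moreover have "1 \<notin> P" if "P \<in> associated_primes I" for P
    using that is_prime_ideal_D(2) unfolding associated_primes_def by blast
  ultimately show "f \<in> symbolic_power I s"
    unfolding symbolic_power_iff by (metis mult_1)
qed

lemma ideal_power_0: "ideal_power I 0 = UNIV"
proof -
  have "1 \<in> ideal_power I 0"
    unfolding ideal_power_def by (rule ideal.span_base) simp
  then show ?thesis
    using is_ideal_mult_left[OF is_ideal_ideal_power, of 1] by auto
qed

lemma mult_in_ideal_power_Suc:
  assumes "f \<in> I" "g \<in> ideal_power I s"
  shows "f * g \<in> ideal_power I (Suc s)"
  using assms(2) unfolding ideal_power_def
proof (induction rule: ideal.span_induct_alt)
  case base
  then show ?case
    by (simp add: ideal.span_zero)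
next
  case (step c x y)
  then obtain h where h: "x = (\<Prod>i<s. h i)" "\<forall>i<s. h i \<in> I"
    by auto
  have "f * x = (\<Prod>i<Suc s. (h(s := f)) i)"
    by (simp add: h mult.commute)
  then have "f * x \<in> {\<Prod>i<Suc s. k i | k. \<forall>i<Suc s. k i \<in> I}"
    using assms(1) h(2) by (auto intro!: exI[of _ "h(s := f)"])
  then have "f * x \<in> ideal_gen {\<Prod>i<Suc s. k i | k. \<forall>i<Suc s. k i \<in> I}"
    by (rule ideal.span_base)
  then have "c * (f * x) + f * y \<in> ideal_gen {\<Prod>i<Suc s. k i | k. \<forall>i<Suc s. k i \<in> I}"
    using step.IH by (intro ideal.span_add ideal.span_scale[of "f * x"])
  then show ?case
    by (simp only: distrib_left mult.left_commute)
qed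


section \<open>Monomial ideals\<close>

definition up_closed :: "'m::comm_monoid_add set \<Rightarrow> bool" where
  "up_closed U \<longleftrightarrow> (\<forall>m\<in>U. \<forall>n. n + m \<in> U)"

text \<open>Monomial ideals are encoded by their exponent sets, so membership is tested term by
  term. The result is an ideal when \<open>U\<close> is up-closed.\<close>

definition monomial_ideal :: "'m set \<Rightarrow> ('m \<Rightarrow>\<^sub>0 'k::zero) set" where
  "monomial_ideal U = {f. Poly_Mapping.keys f \<subseteq> U}"

lemma is_ideal_monomial_ideal:
  fixes U :: "'m::comm_monoid_add set"
  assumes "up_closed U"
  shows "is_ideal (monomial_ideal U :: ('m \<Rightarrow>\<^sub>0 'k::comm_ring_1) set)"
proof (rule ideal.subspaceI)
  show "0 \<in> monomial_ideal U"
    by (simp add: monomial_ideal_def)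
  show "f + g \<in> monomial_ideal U" if "f \<in> monomial_ideal U" "g \<in> monomial_ideal U"
    for f g :: "'m \<Rightarrow>\<^sub>0 'k"
    using that Poly_Mapping.keys_add[of f g] by (auto simp: monomial_ideal_def)
  show "c * f \<in> monomial_ideal U" if "f \<in> monomial_ideal U" for c f :: "'m \<Rightarrow>\<^sub>0 'k"
    using that assms keys_mult[of c f] by (fastforce simp: monomial_ideal_def up_closed_def)
qed

lemma poly_mapping_eq_sum_singles:
  "f = (\<Sum>m\<in>Poly_Mapping.keys f. Poly_Mapping.single m (Poly_Mapping.lookup f m))"
  by (rule poly_mapping_eqI)
    (auto simp: lookup_sum lookup_single when_def in_keys_iff sum.delta)

lemma monomial_ideal_subset:
  fixes J :: "('m::comm_monoid_add \<Rightarrow>\<^sub>0 'k::comm_ring_1) set"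
  assumes J: "is_ideal J" and "\<And>m. m \<in> U \<Longrightarrow> Poly_Mapping.single m 1 \<in> J"
  shows "monomial_ideal U \<subseteq> J"
proof
  fix f :: "'m \<Rightarrow>\<^sub>0 'k"
  assume "f \<in> monomial_ideal U"
  then have "Poly_Mapping.single m (Poly_Mapping.lookup f m) \<in> J"
    if "m \<in> Poly_Mapping.keys f" for m
    using that assms(2)[of m] is_ideal_mult_left[OF J, of "Poly_Mapping.single m 1"
      "Poly_Mapping.single 0 (Poly_Mapping.lookup f m)"]
    by (auto simp: monomial_ideal_def mult_single)
  then show "f \<in> J"
    by (subst poly_mapping_eq_sum_singles) (rule ideal.subspace_sum[OF J])
qed

text \<open>The base value \<open>UNIV\<close>, rather than \<open>{0}\<close>, builds in all
  multiples: these are the exponents of all monomials in the power of the ideal, not only the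
  \<open>s\<close>-fold sums from \<open>G\<close>.\<close>

primrec monomial_power :: "'m::comm_monoid_add set \<Rightarrow> nat \<Rightarrow> 'm set" where
  "monomial_power G 0 = UNIV"
| "monomial_power G (Suc s) = {g + m | g m. g \<in> G \<and> m \<in> monomial_power G s}"

lemma up_closed_monomial_power: "up_closed (monomial_power G s)"
proof (induction s)
  case (Suc s)
  have "n + (g + m) \<in> monomial_power G (Suc s)" if "g \<in> G" "m \<in> monomial_power G s" for n g m
  proof -
    have "n + (g + m) = g + (n + m)" "n + m \<in> monomial_power G s"
      using Suc that by (auto simp: up_closed_def ac_simps)
    then show ?thesis
      using that by auto
  qed
  then show ?case
    unfolding up_closed_def by fastforce
qed (simp add: up_closed_def)

lemma ideal_gen_monomials:
  "ideal_gen ((\<lambda>g. Poly_Mapping.single g 1) ` G) =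
     (monomial_ideal (monomial_power G 1) :: ('m::comm_monoid_add \<Rightarrow>\<^sub>0 'k::comm_ring_1) set)"
  (is "?I = ?M")
proof
  have "g + 0 \<in> monomial_power G 1" if "g \<in> G" for g
    using that by (simp del: add_0_right) blast
  then show "?I \<subseteq> ?M"
    by (intro ideal.span_minimal is_ideal_monomial_ideal up_closed_monomial_power)
      (auto simp: monomial_ideal_def simp del: monomial_power.simps)
  show "?M \<subseteq> ?I"
  proof (rule monomial_ideal_subset)
    fix m assume "m \<in> monomial_power G 1"
    then obtain g n where gn: "g \<in> G" "m = g + n"
      by auto
    then have "Poly_Mapping.single n 1 * Poly_Mapping.single g (1::'k) \<in> ?I"
      by (intro ideal.span_scale ideal.span_base) auto
    then show "Poly_Mapping.single m 1 \<in> ?I"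
      by (simp add: gn mult_single add.commute)
  qed (rule ideal.subspace_span)
qed

lemma ideal_power_monomials:
  fixes G :: "'m::comm_monoid_add set"
  defines "I \<equiv> ideal_gen ((\<lambda>g. Poly_Mapping.single g (1::'k::comm_ring_1)) ` G)"
  shows "ideal_power I s = monomial_ideal (monomial_power G s)"
proof
  have "(\<Prod>i<n. f i) \<in> monomial_ideal (monomial_power G n)"
    if "\<forall>i<n. f i \<in> I" for n and f :: "nat \<Rightarrow> 'm \<Rightarrow>\<^sub>0 'k"
    using that
  proof (induction n)
    case (Suc n)
    have "k \<in> monomial_power G (Suc n)" if k: "k \<in> Poly_Mapping.keys ((\<Prod>i<n. f i) * f n)" for k
    proof -
      obtain a b where ab: "k = a + b" "a \<in> Poly_Mapping.keys (\<Prod>i<n. f i)"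
        "b \<in> Poly_Mapping.keys (f n)"
        using k keys_mult by blast
      have "f n \<in> monomial_ideal (monomial_power G 1)"
        using Suc.prems by (auto simp: I_def ideal_gen_monomials)
      then obtain g c where gc: "g \<in> G" "b = g + c"
        using ab by (auto simp: monomial_ideal_def)
      have "a \<in> monomial_power G n"
        using Suc ab by (auto simp: monomial_ideal_def)
      \<comment> \<open>The part \<open>c\<close> of \<open>b\<close> beyond the generator
        \<open>g\<close> is handed to the other \<open>n\<close> factors, whose exponent set is
        up-closed.\<close>
      then have "c + a \<in> monomial_power G n"
        using up_closed_monomial_power[of G n] by (auto simp: up_closed_def)
      moreover have "k = g + (c + a)"
        by (simp add: ab gc ac_simps)
      ultimately show ?thesis
        using gc by auto
    qed
    then show ?case
      by (auto simp: monomial_ideal_def simp del: monomial_power.simps)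
  qed (simp add: monomial_ideal_def)
  then show "ideal_power I s \<subseteq> monomial_ideal (monomial_power G s)"
    unfolding ideal_power_def
    by (intro ideal.span_minimal is_ideal_monomial_ideal up_closed_monomial_power) auto
  have "Poly_Mapping.single m 1 \<in> ideal_power I s" if "m \<in> monomial_power G s" for m
    using that
  proof (induction s arbitrary: m)
    case (Suc s)
    then obtain g n where gn: "g \<in> G" "m = g + n" "n \<in> monomial_power G s"
      by auto
    have "Poly_Mapping.single g 1 \<in> I"
      unfolding I_def using gn by (intro ideal.span_base) auto
    then have "Poly_Mapping.single g 1 * Poly_Mapping.single n 1 \<in> ideal_power I (Suc s)"
      using Suc.IH gn by (intro mult_in_ideal_power_Suc) auto
    then show ?case
      by (simp add: gn mult_single)
  qed (simp add: ideal_power_0)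
  then show "monomial_ideal (monomial_power G s) \<subseteq> ideal_power I s"
    by (intro monomial_ideal_subset is_ideal_ideal_power)
qed

text \<open>Translation by \<open>g\<close> is injective in a cancellative monoid, so no terms merge
  or cancel.\<close>

lemma keys_times_single:
  fixes f :: "('m::cancel_comm_monoid_add) \<Rightarrow>\<^sub>0 'k::comm_ring_1"
  shows "Poly_Mapping.keys (f * Poly_Mapping.single g 1) = (\<lambda>m. m + g) ` Poly_Mapping.keys f"
proof -
  have "f * Poly_Mapping.single g 1 =
      (\<Sum>m\<in>Poly_Mapping.keys f. Poly_Mapping.single (m + g) (Poly_Mapping.lookup f m))"
    by (subst poly_mapping_eq_sum_singles[of f]) (simp add: sum_distrib_right mult_single)
  then have "Poly_Mapping.lookup (f * Poly_Mapping.single g 1) k =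
      (\<Sum>m\<in>Poly_Mapping.keys f. Poly_Mapping.lookup f m when m + g = k)" for k
    by (simp add: lookup_sum lookup_single)
  moreover have "(\<Sum>m\<in>Poly_Mapping.keys f. Poly_Mapping.lookup f m when m + g = k) \<noteq> 0 \<longleftrightarrow>
      k \<in> (\<lambda>m. m + g) ` Poly_Mapping.keys f" for k
  proof (cases "\<exists>m. k = m + g")
    case True
    then obtain m where "k = m + g"
      by auto
    then show ?thesis
      by (auto simp: when_def sum.delta in_keys_iff)
  next
    case False
    then have "(\<Sum>m\<in>Poly_Mapping.keys f. Poly_Mapping.lookup f m when m + g = k) = 0"
      by (intro sum.neutral) (auto simp: when_def)
    then show ?thesis
      using False by auto
  qed
  ultimately show ?thesis
    by (intro set_eqI) (simp only: in_keys_iff not_False_eq_True)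
qed

lemma poly_mapping_split:
  fixes f :: "'m \<Rightarrow>\<^sub>0 'k::comm_ring_1"
  obtains g h where "f = g + h" "Poly_Mapping.keys g = Poly_Mapping.keys f \<inter> A"
    "Poly_Mapping.keys h = Poly_Mapping.keys f - A"
proof (rule that)
  show "f = Poly_Mapping.mapp (\<lambda>m c. c when m \<in> A) f + Poly_Mapping.mapp (\<lambda>m c. c when m \<notin> A) f"
    by (rule poly_mapping_eqI) (auto simp: lookup_add lookup_mapp when_def in_keys_iff)
qed (simp_all add: set_eq_iff in_keys_iff lookup_mapp when_def)


section \<open>Localization at primes generated by variables\<close>

text \<open>On exponents, this is extension to the ring with all variables outside \<open>S\<close>
  inverted, followed by contraction.\<close>

definition monomial_saturation :: "'v set \<Rightarrow> ('v \<Rightarrow>\<^sub>0 nat) set \<Rightarrow> ('v \<Rightarrow>\<^sub>0 nat) set" where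
  "monomial_saturation S U = {m. \<exists>n. (\<forall>x\<in>S. Poly_Mapping.lookup n x = 0) \<and> m + n \<in> U}"

lemma up_closed_monomial_saturation:
  assumes "up_closed U"
  shows "up_closed (monomial_saturation S U)"
  unfolding up_closed_def
proof (intro ballI allI)
  fix m n assume "m \<in> monomial_saturation S U"
  then obtain l where "\<forall>x\<in>S. Poly_Mapping.lookup l x = 0" "m + l \<in> U"
    by (auto simp: monomial_saturation_def)
  moreover from this have "n + m + l \<in> U"
    using assms by (simp add: up_closed_def add.assoc)
  ultimately show "n + m \<in> monomial_saturation S U"
    by (auto simp: monomial_saturation_def)
qed

definition variable_prime :: "'v set \<Rightarrow> ('v, 'k::field) mpoly set" where
  "variable_prime S = monomial_ideal {m. \<exists>x\<in>S. Poly_Mapping.lookup m x \<noteq> 0}"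

text \<open>Grade by the total degree in the variables from \<open>S\<close>. If \<open>h\<close> collects the terms of \<open>f\<close>
  outside the saturation, then the lowest-degree component of \<open>u * h\<close> is the product of the
  lowest component of \<open>h\<close> with the nonzero degree-zero component of \<open>u\<close>.\<close>

lemma monomial_ideal_saturation:
  fixes f u :: "('v::linorder, 'k::field) mpoly"
  assumes U: "up_closed U" and S: "finite S"
    and u: "u \<notin> variable_prime S" and uf: "u * f \<in> monomial_ideal U"
  shows "f \<in> monomial_ideal (monomial_saturation S U)"
proof (rule ccontr)
  let ?T = "monomial_saturation S U"
  define deg where "deg m = (\<Sum>x\<in>S. Poly_Mapping.lookup m x)" for m :: "'v \<Rightarrow>\<^sub>0 nat"
  have deg_add: "deg (m + n) = deg m + deg n" for m n
    by (simp add: deg_def lookup_add sum.distrib)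
  have deg_0: "deg m = 0 \<longleftrightarrow> (\<forall>x\<in>S. Poly_Mapping.lookup m x = 0)" for m
    using S by (simp add: deg_def)
  assume "f \<notin> monomial_ideal ?T"
  obtain g h where gh: "f = g + h" "Poly_Mapping.keys g = Poly_Mapping.keys f \<inter> ?T"
    "Poly_Mapping.keys h = Poly_Mapping.keys f - ?T"
    by (rule poly_mapping_split)
  have T: "is_ideal (monomial_ideal ?T :: ('v, 'k) mpoly set)"
    by (intro is_ideal_monomial_ideal up_closed_monomial_saturation U)
  have "U \<subseteq> ?T"
    by (auto simp: monomial_saturation_def intro!: exI[of _ 0])
  then have "u * f \<in> monomial_ideal ?T"
    using uf by (auto simp: monomial_ideal_def)
  moreover have "u * g \<in> monomial_ideal ?T"
    by (intro is_ideal_mult_left[OF T]) (auto simp: monomial_ideal_def gh)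
  moreover have "u * h = u * f - u * g"
    by (simp add: gh algebra_simps)
  ultimately have uh: "u * h \<in> monomial_ideal ?T"
    using ideal.subspace_diff[OF T] by simp
  have "Poly_Mapping.keys h \<noteq> {}"
    using \<open>f \<notin> monomial_ideal ?T\<close> gh(3) by (auto simp: monomial_ideal_def)
  define d where "d = Min (deg ` Poly_Mapping.keys h)"
  have d_le: "d \<le> deg m" if "m \<in> Poly_Mapping.keys h" for m
    using that by (simp add: d_def)
  have "d \<in> deg ` Poly_Mapping.keys h"
    unfolding d_def using \<open>Poly_Mapping.keys h \<noteq> {}\<close> by (intro Min_in) auto
  then obtain m\<^sub>0 where m\<^sub>0: "m\<^sub>0 \<in> Poly_Mapping.keys h" "deg m\<^sub>0 = d"
    by auto
  obtain h\<^sub>0 h\<^sub>1 where h: "h = h\<^sub>0 + h\<^sub>1" "Poly_Mapping.keys h\<^sub>0 = Poly_Mapping.keys h \<inter> {m. deg m = d}"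
    "Poly_Mapping.keys h\<^sub>1 = Poly_Mapping.keys h - {m. deg m = d}"
    by (rule poly_mapping_split)
  obtain u\<^sub>0 u\<^sub>1 where u01: "u = u\<^sub>0 + u\<^sub>1" "Poly_Mapping.keys u\<^sub>0 = Poly_Mapping.keys u \<inter> {m. deg m = 0}"
    "Poly_Mapping.keys u\<^sub>1 = Poly_Mapping.keys u - {m. deg m = 0}"
    by (rule poly_mapping_split)
  have "h\<^sub>0 \<noteq> 0"
    using m\<^sub>0 h(2) by auto
  moreover have "u\<^sub>0 \<noteq> 0"
    using u u01(2) by (auto simp: variable_prime_def monomial_ideal_def deg_0)
  ultimately have "u\<^sub>0 * h\<^sub>0 \<noteq> 0"
    by simp
  then obtain k where k: "k \<in> Poly_Mapping.keys (u\<^sub>0 * h\<^sub>0)"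
    using poly_mapping_eqI[of "u\<^sub>0 * h\<^sub>0" 0] by (auto simp: in_keys_iff)
  then obtain n m where nm: "k = n + m" "n \<in> Poly_Mapping.keys u\<^sub>0" "m \<in> Poly_Mapping.keys h\<^sub>0"
    using keys_mult by blast
  have "deg k = d"
    using nm h(2) u01(2) by (auto simp: deg_add)
  have "k \<notin> Poly_Mapping.keys (u\<^sub>1 * h\<^sub>0)"
  proof
    assume "k \<in> Poly_Mapping.keys (u\<^sub>1 * h\<^sub>0)"
    then obtain a b where "k = a + b" "a \<in> Poly_Mapping.keys u\<^sub>1" "b \<in> Poly_Mapping.keys h\<^sub>0"
      using keys_mult by blast
    then show False
      using \<open>deg k = d\<close> h(2) u01(3) by (auto simp: deg_add)
  qed
  moreover have "k \<notin> Poly_Mapping.keys (u * h\<^sub>1)"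
  proof
    assume "k \<in> Poly_Mapping.keys (u * h\<^sub>1)"
    then obtain a b where ab: "k = a + b" "b \<in> Poly_Mapping.keys h\<^sub>1"
      using keys_mult by blast
    then have "d \<le> deg b" "deg b \<noteq> d"
      using h(3) d_le by auto
    then show False
      using \<open>deg k = d\<close> ab(1) by (simp add: deg_add)
  qed
  moreover have "u * h = u\<^sub>0 * h\<^sub>0 + (u\<^sub>1 * h\<^sub>0 + u * h\<^sub>1)"
    by (simp add: h(1) u01(1) algebra_simps)
  ultimately have "k \<in> Poly_Mapping.keys (u * h)"
    using k by (simp add: in_keys_iff lookup_add)
  then have "k \<in> ?T"
    using uh by (auto simp: monomial_ideal_def)
  then obtain l where "\<forall>x\<in>S. Poly_Mapping.lookup l x = 0" "k + l \<in> U"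
    by (auto simp: monomial_saturation_def)
  moreover have "\<forall>x\<in>S. Poly_Mapping.lookup n x = 0"
    using nm(2) u01(2) by (auto simp: deg_0)
  \<comment> \<open>Since \<open>n\<close> involves no variable from \<open>S\<close>, the exponent
    \<open>n + l\<close> certifies \<open>m\<close>, although \<open>h\<close> has only terms
    outside \<open>?T\<close>.\<close>
  ultimately have "m \<in> ?T"
    unfolding monomial_saturation_def nm(1)
    by (intro CollectI exI[of _ "n + l"]) (auto simp: lookup_add ac_simps)
  then show False
    using nm(3) h(2) gh(3) by auto
qed

text \<open>The exponent set of this ideal is its own saturation, so
  \<open>monomial_ideal_saturation\<close> becomes exactly the cancellation property of a
  prime.\<close>

lemma is_prime_ideal_variable_prime:
  assumes "finite S"
  shows "is_prime_ideal (variable_prime S :: ('v::linorder, 'k::field) mpoly set)"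
proof -
  let ?U = "{m. \<exists>x\<in>S. Poly_Mapping.lookup m x \<noteq> (0::nat)}"
  have U: "up_closed ?U"
    by (auto simp: up_closed_def lookup_add)
  have sat: "monomial_saturation S ?U = ?U"
    by (auto simp: monomial_saturation_def lookup_add intro!: exI[of _ 0])
  have "(1 :: ('v, 'k) mpoly) \<notin> variable_prime S"
    by (auto simp: variable_prime_def monomial_ideal_def)
  moreover have "b \<in> variable_prime S"
    if "a * b \<in> variable_prime S" "a \<notin> variable_prime S" for a b :: "('v, 'k) mpoly"
    using monomial_ideal_saturation[OF U assms that(2), of b] that(1)
    unfolding sat by (simp add: variable_prime_def)
  moreover have "is_ideal (variable_prime S :: ('v, 'k) mpoly set)"
    unfolding variable_prime_def by (rule is_ideal_monomial_ideal[OF U])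
  ultimately show ?thesis
    unfolding is_prime_ideal_def by blast
qed

text \<open>Multiplication by a monomial only shifts exponents, so a condition on exponents
  determines the whole annihilator of the monomial \<open>g\<close> modulo the ideal.\<close>

lemma variable_prime_associated:
  assumes "finite S"
    and "\<And>m. m + g \<in> U \<longleftrightarrow> (\<exists>x\<in>S. Poly_Mapping.lookup m x \<noteq> 0)"
  shows "(variable_prime S :: ('v::linorder, 'k::field) mpoly set) \<in>
    associated_primes (monomial_ideal U)"
proof -
  have "(variable_prime S :: ('v, 'k) mpoly set) =
      {r. r * Poly_Mapping.single g 1 \<in> monomial_ideal U}"
    using assms(2) by (auto simp: variable_prime_def monomial_ideal_def keys_times_single)
  then show ?thesis
    using is_prime_ideal_variable_prime[OF assms(1)] unfolding associated_primes_def by blast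
qed


section \<open>The weighted naturally oriented four-cycle\<close>

lemma var_power:
  "var x ^ n = (Poly_Mapping.single (Poly_Mapping.single x n) 1 :: ('v, 'k::field) mpoly)"
  by (induction n) (simp_all add: var_def mult_single flip: single_add)

lemma Suc_le_add_self_iff: "Suc n \<le> k + n \<longleftrightarrow> k \<noteq> 0"
  by auto

text \<open>Only the bound \<alpha> + \<beta> \<le> \<open>q\<close> is missing. The excess \<delta>
  is moved from \<beta> to \<gamma>: this does not raise the cost against \<open>r\<close> because
  \<open>b\<close> is at least 1, and the new \<gamma> equals \<open>s - q\<close>, which is at most
  \<open>t\<close>.\<close>

lemma edge_multiplicities_of_first_bound:
  fixes p q r t s b \<alpha> \<beta> \<gamma> :: nat
  assumes "s \<le> q + t" "\<alpha> + \<beta> + \<gamma> = s" "\<alpha> \<le> p" "b * \<beta> + \<gamma> \<le> r" "\<gamma> \<le> t" "b \<ge> 1" "\<alpha> \<le> q"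
  shows "\<exists>n\<^sub>1 n\<^sub>2 n\<^sub>3. n\<^sub>1 + n\<^sub>2 + n\<^sub>3 = s \<and> n\<^sub>1 \<le> p \<and> n\<^sub>1 + n\<^sub>2 \<le> q \<and> b * n\<^sub>2 + n\<^sub>3 \<le> r \<and> n\<^sub>3 \<le> t"
proof (cases "\<alpha> + \<beta> \<le> q")
  case True
  then show ?thesis
    using assms by blast
next
  case False
  define \<delta> where "\<delta> = \<beta> - (q - \<alpha>)"
  have \<beta>: "\<beta> = (q - \<alpha>) + \<delta>"
    using False by (simp add: \<delta>_def)
  have "\<delta> \<le> b * \<delta>"
    using \<open>b \<ge> 1\<close> by simp
  moreover have "b * (q - \<alpha>) + b * \<delta> + \<gamma> \<le> r"
    using assms(4) unfolding \<beta> by (simp add: distrib_left)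
  ultimately have "b * (q - \<alpha>) + (\<gamma> + \<delta>) \<le> r"
    by linarith
  moreover have "\<alpha> + (q - \<alpha>) + (\<gamma> + \<delta>) = s" "\<gamma> + \<delta> \<le> t"
    using assms \<beta> by linarith+
  ultimately show ?thesis
    using assms by - (rule exI[of _ \<alpha>], rule exI[of _ "q - \<alpha>"], rule exI[of _ "\<gamma> + \<delta>"], simp)
qed

text \<open>Here \<open>p\<close>, \<open>q\<close>, \<open>r\<close>, \<open>t\<close> are the
  exponents of the four vertices in cyclic order, and \<open>a\<close>, \<open>b\<close> are the
  weights of the first and third, the other two weights being 1. The two partial solutions are
  exchanged by a half turn of the cycle, so the previous lemma repairs either one, with
  \<open>n\<^sub>4 = 0\<close> or \<open>n\<^sub>2 = 0\<close> respectively.\<close>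

lemma edge_multiplicities_of_localized_bounds:
  fixes p q r t s a b \<alpha> \<beta> \<gamma> \<alpha>' \<beta>' \<gamma>' :: nat
  assumes qt: "s \<le> q + t" and ab: "a \<ge> 1" "b \<ge> 1"
    and 1: "\<alpha> + \<beta> + \<gamma> = s" "\<alpha> \<le> p" "b * \<beta> + \<gamma> \<le> r" "\<gamma> \<le> t"
    and 2: "\<alpha>' + \<beta>' + \<gamma>' = s" "\<alpha>' \<le> r" "a * \<beta>' + \<gamma>' \<le> p" "\<gamma>' \<le> q"
  shows "\<exists>n\<^sub>1 n\<^sub>2 n\<^sub>3 n\<^sub>4. n\<^sub>1 + n\<^sub>2 + n\<^sub>3 + n\<^sub>4 = s \<and> n\<^sub>1 + a * n\<^sub>4 \<le> p \<and> n\<^sub>1 + n\<^sub>2 \<le> q \<and>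
    b * n\<^sub>2 + n\<^sub>3 \<le> r \<and> n\<^sub>3 + n\<^sub>4 \<le> t"
proof -
  consider "\<alpha> \<le> q" | "\<alpha>' \<le> t" | "q < \<alpha>" "t < \<alpha>'"
    by linarith
  then show ?thesis
  proof cases
    case 1
    then obtain n\<^sub>1 n\<^sub>2 n\<^sub>3 where "n\<^sub>1 + n\<^sub>2 + n\<^sub>3 = s" "n\<^sub>1 \<le> p" "n\<^sub>1 + n\<^sub>2 \<le> q"
      "b * n\<^sub>2 + n\<^sub>3 \<le> r" "n\<^sub>3 \<le> t"
      using edge_multiplicities_of_first_bound[OF qt assms(4-7) ab(2)] by blast
    then show ?thesis
      by - (rule exI[of _ n\<^sub>1], rule exI[of _ n\<^sub>2], rule exI[of _ n\<^sub>3], rule exI[of _ 0], simp)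
  next
    case 2
    have "s \<le> t + q"
      using qt by simp
    from edge_multiplicities_of_first_bound[OF this assms(8-11) ab(1) 2]
    obtain n\<^sub>3 n\<^sub>4 n\<^sub>1 where "n\<^sub>3 + n\<^sub>4 + n\<^sub>1 = s" "n\<^sub>3 \<le> r" "n\<^sub>3 + n\<^sub>4 \<le> t"
      "a * n\<^sub>4 + n\<^sub>1 \<le> p" "n\<^sub>1 \<le> q"
      by blast
    then show ?thesis
      by - (rule exI[of _ n\<^sub>1], rule exI[of _ 0], rule exI[of _ n\<^sub>3], rule exI[of _ n\<^sub>4], simp)
  next
    \<comment> \<open>Now \<open>q < p\<close> and \<open>t < r\<close>, so the two disjoint edges
      into the vertices of weight 1 suffice: use the first as often as \<open>q\<close> and
      \<open>s\<close> allow and the third for the rest, at most \<open>t\<close> times.\<close>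
    case 3
    then show ?thesis
      using qt 1(2) 2(2)
      by - (rule exI[of _ "min q s"], rule exI[of _ 0], rule exI[of _ "s - min q s"], rule exI[of _ 0],
          auto simp: min_def)
  qed
qed

text \<open>The labels are parameters so that every result transfers to the rotations of the cycle
  by interpreting the locale again.\<close>

locale weighted_four_cycle =
  fixes w :: "'v::{finite,linorder} \<Rightarrow> nat" and x\<^sub>1 x\<^sub>2 x\<^sub>3 x\<^sub>4 :: 'v
  assumes distinct: "distinct [x\<^sub>1, x\<^sub>2, x\<^sub>3, x\<^sub>4]"
    and vertices: "UNIV = {x\<^sub>1, x\<^sub>2, x\<^sub>3, x\<^sub>4}"
    and weight_pos: "w v \<ge> 1"
begin

section \<open>Powers of the edge ideal as linear systems\<close>

definition edge_monomials :: "('v \<Rightarrow>\<^sub>0 nat) set" where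
  "edge_monomials =
     {Poly_Mapping.single x\<^sub>1 1 + Poly_Mapping.single x\<^sub>2 (w x\<^sub>2),
      Poly_Mapping.single x\<^sub>2 1 + Poly_Mapping.single x\<^sub>3 (w x\<^sub>3),
      Poly_Mapping.single x\<^sub>3 1 + Poly_Mapping.single x\<^sub>4 (w x\<^sub>4),
      Poly_Mapping.single x\<^sub>4 1 + Poly_Mapping.single x\<^sub>1 (w x\<^sub>1)}"

lemma neq: "x\<^sub>1 \<noteq> x\<^sub>2" "x\<^sub>1 \<noteq> x\<^sub>3" "x\<^sub>1 \<noteq> x\<^sub>4" "x\<^sub>2 \<noteq> x\<^sub>3" "x\<^sub>2 \<noteq> x\<^sub>4" "x\<^sub>3 \<noteq> x\<^sub>4"
  using distinct by auto

lemma all_vertices_iff: "(\<forall>v. P v) \<longleftrightarrow> P x\<^sub>1 \<and> P x\<^sub>2 \<and> P x\<^sub>3 \<and> P x\<^sub>4"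
  using vertices by (metis UNIV_I empty_iff insert_iff)

lemmas lookup_vertex_simps = lookup_add lookup_single when_def neq neq[symmetric]

text \<open>Each \<open>n\<^sub>i\<close> is the multiplicity of the edge leaving
  \<open>x\<^sub>i\<close>. A vertex pays 1 for every use of its outgoing edge and its weight for
  every use of its incoming edge; the inequalities say that the product of the edge monomials
  divides \<open>m\<close>.\<close>

definition dominates :: "('v \<Rightarrow>\<^sub>0 nat) \<Rightarrow> nat \<Rightarrow> nat \<Rightarrow> nat \<Rightarrow> nat \<Rightarrow> bool" where
  "dominates m n\<^sub>1 n\<^sub>2 n\<^sub>3 n\<^sub>4 \<longleftrightarrow>
     n\<^sub>1 + w x\<^sub>1 * n\<^sub>4 \<le> Poly_Mapping.lookup m x\<^sub>1 \<and> w x\<^sub>2 * n\<^sub>1 + n\<^sub>2 \<le> Poly_Mapping.lookup m x\<^sub>2 \<and>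
     w x\<^sub>3 * n\<^sub>2 + n\<^sub>3 \<le> Poly_Mapping.lookup m x\<^sub>3 \<and> w x\<^sub>4 * n\<^sub>3 + n\<^sub>4 \<le> Poly_Mapping.lookup m x\<^sub>4"

lemma in_monomial_power_Suc:
  assumes "g \<in> edge_monomials" "m - g \<in> monomial_power edge_monomials s"
    and "\<And>v. Poly_Mapping.lookup g v \<le> Poly_Mapping.lookup m v"
  shows "m \<in> monomial_power edge_monomials (Suc s)"
proof -
  have "m = g + (m - g)"
    \<comment> \<open>Subtraction of exponents is truncated; the pointwise bound makes it
      exact.\<close>
    using assms(3) by (intro poly_mapping_eqI) (simp add: lookup_add lookup_minus)
  then show ?thesis
    using assms(1,2) by auto
qed

text \<open>Induction on \<open>s\<close>: multiplying by an edge monomial raises one multiplicity,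
  and conversely an edge with positive multiplicity can be split off.\<close>

lemma monomial_power_iff:
  "m \<in> monomial_power edge_monomials s \<longleftrightarrow>
     (\<exists>n\<^sub>1 n\<^sub>2 n\<^sub>3 n\<^sub>4. n\<^sub>1 + n\<^sub>2 + n\<^sub>3 + n\<^sub>4 = s \<and> dominates m n\<^sub>1 n\<^sub>2 n\<^sub>3 n\<^sub>4)"
proof (induction s arbitrary: m)
  case 0
  then show ?case
    by (auto simp: dominates_def)
next
  case (Suc s)
  show ?case
  proof
    assume "m \<in> monomial_power edge_monomials (Suc s)"
    then obtain g m' n\<^sub>1 n\<^sub>2 n\<^sub>3 n\<^sub>4 where *: "g \<in> edge_monomials" "m = g + m'"
      "n\<^sub>1 + n\<^sub>2 + n\<^sub>3 + n\<^sub>4 = s" "dominates m' n\<^sub>1 n\<^sub>2 n\<^sub>3 n\<^sub>4"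
      using Suc by auto
    then have "dominates m (Suc n\<^sub>1) n\<^sub>2 n\<^sub>3 n\<^sub>4 \<or> dominates m n\<^sub>1 (Suc n\<^sub>2) n\<^sub>3 n\<^sub>4 \<or>
        dominates m n\<^sub>1 n\<^sub>2 (Suc n\<^sub>3) n\<^sub>4 \<or> dominates m n\<^sub>1 n\<^sub>2 n\<^sub>3 (Suc n\<^sub>4)"
      by (auto simp: dominates_def edge_monomials_def lookup_vertex_simps)
    moreover have "Suc n\<^sub>1 + n\<^sub>2 + n\<^sub>3 + n\<^sub>4 = Suc s" "n\<^sub>1 + Suc n\<^sub>2 + n\<^sub>3 + n\<^sub>4 = Suc s"
        "n\<^sub>1 + n\<^sub>2 + Suc n\<^sub>3 + n\<^sub>4 = Suc s" "n\<^sub>1 + n\<^sub>2 + n\<^sub>3 + Suc n\<^sub>4 = Suc s"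
      using * by auto
    ultimately show "\<exists>n\<^sub>1 n\<^sub>2 n\<^sub>3 n\<^sub>4. n\<^sub>1 + n\<^sub>2 + n\<^sub>3 + n\<^sub>4 = Suc s \<and> dominates m n\<^sub>1 n\<^sub>2 n\<^sub>3 n\<^sub>4"
      by metis
  next
    assume "\<exists>n\<^sub>1 n\<^sub>2 n\<^sub>3 n\<^sub>4. n\<^sub>1 + n\<^sub>2 + n\<^sub>3 + n\<^sub>4 = Suc s \<and> dominates m n\<^sub>1 n\<^sub>2 n\<^sub>3 n\<^sub>4"
    then obtain n\<^sub>1 n\<^sub>2 n\<^sub>3 n\<^sub>4 where n: "n\<^sub>1 + n\<^sub>2 + n\<^sub>3 + n\<^sub>4 = Suc s" "dominates m n\<^sub>1 n\<^sub>2 n\<^sub>3 n\<^sub>4"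
      by auto
    then consider k where "n\<^sub>1 = Suc k" | k where "n\<^sub>2 = Suc k" | k where "n\<^sub>3 = Suc k"
      | k where "n\<^sub>4 = Suc k"
      by (metis add.right_neutral nat.exhaust nat.distinct(1))
    then show "m \<in> monomial_power edge_monomials (Suc s)"
    proof cases
      case 1
      let ?g = "Poly_Mapping.single x\<^sub>1 1 + Poly_Mapping.single x\<^sub>2 (w x\<^sub>2)"
      have "dominates (m - ?g) k n\<^sub>2 n\<^sub>3 n\<^sub>4"
        using n(2) by (auto simp: dominates_def 1 lookup_minus lookup_vertex_simps)
      moreover have "k + n\<^sub>2 + n\<^sub>3 + n\<^sub>4 = s"
        using n(1) 1 by simp
      moreover have "\<forall>v. Poly_Mapping.lookup ?g v \<le> Poly_Mapping.lookup m v"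
        unfolding all_vertices_iff using n(2) by (simp add: dominates_def 1 lookup_vertex_simps)
      ultimately show ?thesis
        using Suc.IH by (intro in_monomial_power_Suc[of ?g]) (auto simp: edge_monomials_def)
    next
      case 2
      let ?g = "Poly_Mapping.single x\<^sub>2 1 + Poly_Mapping.single x\<^sub>3 (w x\<^sub>3)"
      have "dominates (m - ?g) n\<^sub>1 k n\<^sub>3 n\<^sub>4"
        using n(2) by (auto simp: dominates_def 2 lookup_minus lookup_vertex_simps)
      moreover have "n\<^sub>1 + k + n\<^sub>3 + n\<^sub>4 = s"
        using n(1) 2 by simp
      moreover have "\<forall>v. Poly_Mapping.lookup ?g v \<le> Poly_Mapping.lookup m v"
        unfolding all_vertices_iff using n(2) by (simp add: dominates_def 2 lookup_vertex_simps)
      ultimately show ?thesis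
        using Suc.IH by (intro in_monomial_power_Suc[of ?g]) (auto simp: edge_monomials_def)
    next
      case 3
      let ?g = "Poly_Mapping.single x\<^sub>3 1 + Poly_Mapping.single x\<^sub>4 (w x\<^sub>4)"
      have "dominates (m - ?g) n\<^sub>1 n\<^sub>2 k n\<^sub>4"
        using n(2) by (auto simp: dominates_def 3 lookup_minus lookup_vertex_simps)
      moreover have "n\<^sub>1 + n\<^sub>2 + k + n\<^sub>4 = s"
        using n(1) 3 by simp
      moreover have "\<forall>v. Poly_Mapping.lookup ?g v \<le> Poly_Mapping.lookup m v"
        unfolding all_vertices_iff using n(2) by (simp add: dominates_def 3 lookup_vertex_simps)
      ultimately show ?thesis
        using Suc.IH by (intro in_monomial_power_Suc[of ?g]) (auto simp: edge_monomials_def)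
    next
      case 4
      let ?g = "Poly_Mapping.single x\<^sub>4 1 + Poly_Mapping.single x\<^sub>1 (w x\<^sub>1)"
      have "dominates (m - ?g) n\<^sub>1 n\<^sub>2 n\<^sub>3 k"
        using n(2) by (auto simp: dominates_def 4 lookup_minus lookup_vertex_simps)
      moreover have "n\<^sub>1 + n\<^sub>2 + n\<^sub>3 + k = s"
        using n(1) 4 by simp
      moreover have "\<forall>v. Poly_Mapping.lookup ?g v \<le> Poly_Mapping.lookup m v"
        unfolding all_vertices_iff using n(2) by (simp add: dominates_def 4 lookup_vertex_simps)
      ultimately show ?thesis
        using Suc.IH by (intro in_monomial_power_Suc[of ?g]) (auto simp: edge_monomials_def)
    qed
  qed
qed

lemma monomial_power_1_iff:
  "m \<in> monomial_power edge_monomials 1 \<longleftrightarrow>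
     1 \<le> Poly_Mapping.lookup m x\<^sub>1 \<and> w x\<^sub>2 \<le> Poly_Mapping.lookup m x\<^sub>2 \<or>
     1 \<le> Poly_Mapping.lookup m x\<^sub>2 \<and> w x\<^sub>3 \<le> Poly_Mapping.lookup m x\<^sub>3 \<or>
     1 \<le> Poly_Mapping.lookup m x\<^sub>3 \<and> w x\<^sub>4 \<le> Poly_Mapping.lookup m x\<^sub>4 \<or>
     1 \<le> Poly_Mapping.lookup m x\<^sub>4 \<and> w x\<^sub>1 \<le> Poly_Mapping.lookup m x\<^sub>1" (is "_ \<longleftrightarrow> ?R")
proof -
  have "n\<^sub>1 + n\<^sub>2 + n\<^sub>3 + n\<^sub>4 = 1 \<longleftrightarrow> (n\<^sub>1, n\<^sub>2, n\<^sub>3, n\<^sub>4) \<in>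
      {(1, 0, 0, 0), (0, 1, 0, 0), (0, 0, 1, 0), (0, 0, 0, 1)}" for n\<^sub>1 n\<^sub>2 n\<^sub>3 n\<^sub>4 :: nat
    by auto
  then have "m \<in> monomial_power edge_monomials 1 \<longleftrightarrow>
      dominates m 1 0 0 0 \<or> dominates m 0 1 0 0 \<or> dominates m 0 0 1 0 \<or> dominates m 0 0 0 1"
    unfolding monomial_power_iff by (simp del: One_nat_def) blast
  also have "\<dots> \<longleftrightarrow> ?R"
    by (auto simp: dominates_def)
  finally show ?thesis .
qed

lemma edge_ideal_eq:
  assumes "E = {(x\<^sub>1, x\<^sub>2), (x\<^sub>2, x\<^sub>3), (x\<^sub>3, x\<^sub>4), (x\<^sub>4, x\<^sub>1)}"
  shows "edge_ideal E w = ideal_gen ((\<lambda>g. Poly_Mapping.single g (1::'k::field)) ` edge_monomials)"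
proof -
  have "var x * var y ^ n =
      Poly_Mapping.single (Poly_Mapping.single x 1 + Poly_Mapping.single y n) (1::'k)"
    for x y :: 'v and n
    by (simp add: var_power) (simp add: var_def mult_single)
  moreover have "{var x * var y ^ w y | x y. (x, y) \<in> E} =
      {var x\<^sub>1 * var x\<^sub>2 ^ w x\<^sub>2, var x\<^sub>2 * var x\<^sub>3 ^ w x\<^sub>3, var x\<^sub>3 * var x\<^sub>4 ^ w x\<^sub>4,
       var x\<^sub>4 * var x\<^sub>1 ^ w x\<^sub>1 :: ('v, 'k) mpoly}"
    unfolding assms by blast
  ultimately show ?thesis
    unfolding edge_ideal_def edge_monomials_def by simp
qed

section \<open>Comparison of symbolic and ordinary powers\<close>

context
  fixes I :: "('v, 'k::field) mpoly set"
  assumes I: "I = ideal_gen ((\<lambda>g. Poly_Mapping.single g 1) ` edge_monomials)"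
begin

lemma edge_ideal_monomial: "I = monomial_ideal (monomial_power edge_monomials 1)"
  unfolding I by (rule ideal_gen_monomials)

lemma edge_ideal_power: "ideal_power I s = monomial_ideal (monomial_power edge_monomials s)"
  unfolding I by (rule ideal_power_monomials)

text \<open>The monomial \<open>g\<close> exhibits the prime generated by \<open>S\<close> as
  associated. The exponent \<open>l\<close> is free outside \<open>S\<close>, so only the
  inequalities at vertices of \<open>S\<close> constrain \<open>m\<close> itself.\<close>

lemma symbolic_power_keys:
  assumes "\<And>m. m + g \<in> monomial_power edge_monomials 1 \<longleftrightarrow>
      (\<exists>x\<in>S. Poly_Mapping.lookup m x \<noteq> 0)"
    and "f \<in> symbolic_power I s" "m \<in> Poly_Mapping.keys f"
  obtains l n\<^sub>1 n\<^sub>2 n\<^sub>3 n\<^sub>4 where "\<forall>x\<in>S. Poly_Mapping.lookup l x = 0"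
    "n\<^sub>1 + n\<^sub>2 + n\<^sub>3 + n\<^sub>4 = s" "dominates (m + l) n\<^sub>1 n\<^sub>2 n\<^sub>3 n\<^sub>4"
proof -
  have "variable_prime S \<in> associated_primes I"
    unfolding edge_ideal_monomial by (rule variable_prime_associated[OF _ assms(1)]) auto
  then obtain u where "u \<notin> variable_prime S" "u * f \<in> monomial_ideal (monomial_power edge_monomials s)"
    using assms(2) by (auto simp: symbolic_power_iff edge_ideal_power)
  then have "f \<in> monomial_ideal (monomial_saturation S (monomial_power edge_monomials s))"
    by (intro monomial_ideal_saturation up_closed_monomial_power) auto
  then have "m \<in> monomial_saturation S (monomial_power edge_monomials s)"
    using assms(3) by (auto simp: monomial_ideal_def)
  then show thesis
    using that by (auto simp: monomial_saturation_def monomial_power_iff)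
qed

lemma symbolic_power_eq_all_nontrivial:
  assumes "\<And>v. w v \<ge> 2"
  shows "symbolic_power I s = ideal_power I s"
proof
  \<comment> \<open>A socle monomial modulo \<open>I\<close>: no vertex reaches its weight, but
    every vertex is present, so multiplying by any variable completes its incoming edge.\<close>
  let ?g = "Poly_Mapping.single x\<^sub>1 (w x\<^sub>1 - 1) + Poly_Mapping.single x\<^sub>2 (w x\<^sub>2 - 1) +
    (Poly_Mapping.single x\<^sub>3 (w x\<^sub>3 - 1) + Poly_Mapping.single x\<^sub>4 (w x\<^sub>4 - 1))"
  have g: "m + ?g \<in> monomial_power edge_monomials 1 \<longleftrightarrow>
      (\<exists>x\<in>UNIV. Poly_Mapping.lookup m x \<noteq> 0)" for m
  proof -
    have w: "w v \<le> n + (w v - 1) \<longleftrightarrow> n \<noteq> 0" "1 \<le> n + (w v - 1) \<longleftrightarrow> True" for n v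
      using assms[of v] by auto
    show ?thesis
      unfolding monomial_power_1_iff vertices
      by (auto simp add: lookup_vertex_simps w simp del: One_nat_def)
  qed
  show "symbolic_power I s \<subseteq> ideal_power I s"
  proof
    fix f assume f: "f \<in> symbolic_power I s"
    have "m \<in> monomial_power edge_monomials s" if "m \<in> Poly_Mapping.keys f" for m
    proof (rule symbolic_power_keys[OF g f that])
      fix l n\<^sub>1 n\<^sub>2 n\<^sub>3 n\<^sub>4
      assume l: "\<forall>x\<in>UNIV. Poly_Mapping.lookup l x = 0" and n: "n\<^sub>1 + n\<^sub>2 + n\<^sub>3 + n\<^sub>4 = s"
        "dominates (m + l) n\<^sub>1 n\<^sub>2 n\<^sub>3 n\<^sub>4"
      from l have "l = 0"
        by (intro poly_mapping_eqI) simp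
      with n show ?thesis
        unfolding monomial_power_iff by auto
    qed
    then show "f \<in> ideal_power I s"
      by (auto simp: edge_ideal_power monomial_ideal_def)
  qed
qed (rule ideal_power_subset_symbolic_power)

lemma symbolic_power_eq_alternating:
  assumes "w x\<^sub>2 = 1" "w x\<^sub>4 = 1"
  shows "symbolic_power I s = ideal_power I s"
proof
  define a b where "a = w x\<^sub>1" and "b = w x\<^sub>3"
  have ab: "a \<ge> 1" "b \<ge> 1"
    unfolding a_def b_def by (rule weight_pos)+
  have g1: "m + (Poly_Mapping.single x\<^sub>1 a + Poly_Mapping.single x\<^sub>3 b) \<in> monomial_power edge_monomials 1
      \<longleftrightarrow> (\<exists>x\<in>{x\<^sub>2, x\<^sub>4}. Poly_Mapping.lookup m x \<noteq> 0)" for m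
    unfolding monomial_power_1_iff assms a_def[symmetric] b_def[symmetric] using ab
    by (cases a; cases b) (auto simp: lookup_vertex_simps Suc_le_add_self_iff)
  \<comment> \<open>The vertex \<open>x\<^sub>4\<close> enters the prime only through the edge from
    \<open>x\<^sub>3\<close>, and \<open>x\<^sub>3\<close> divides this monomial only if
    \<open>b\<close> is at least 2. The same happens for \<open>x\<^sub>2\<close> in
    \<open>g3\<close>.\<close>
  have g2: "m + (Poly_Mapping.single x\<^sub>2 1 + Poly_Mapping.single x\<^sub>3 (b - 1)) \<in> monomial_power edge_monomials 1
      \<longleftrightarrow> (\<exists>x\<in>{x\<^sub>1, x\<^sub>3} \<union> (if b = 1 then {} else {x\<^sub>4}). Poly_Mapping.lookup m x \<noteq> 0)" for m
    unfolding monomial_power_1_iff assms a_def[symmetric] b_def[symmetric] using ab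
    by (cases a; cases b) (auto simp: lookup_vertex_simps Suc_le_add_self_iff)
  have g3: "m + (Poly_Mapping.single x\<^sub>4 1 + Poly_Mapping.single x\<^sub>1 (a - 1)) \<in> monomial_power edge_monomials 1
      \<longleftrightarrow> (\<exists>x\<in>{x\<^sub>1, x\<^sub>3} \<union> (if a = 1 then {} else {x\<^sub>2}). Poly_Mapping.lookup m x \<noteq> 0)" for m
    unfolding monomial_power_1_iff assms a_def[symmetric] b_def[symmetric] using ab
    by (cases a; cases b) (auto simp: lookup_vertex_simps Suc_le_add_self_iff)
  show "symbolic_power I s \<subseteq> ideal_power I s"
  proof
    fix f assume f: "f \<in> symbolic_power I s"
    have "m \<in> monomial_power edge_monomials s" if m: "m \<in> Poly_Mapping.keys f" for m
    proof -
      define p q r t where "p = Poly_Mapping.lookup m x\<^sub>1" and "q = Poly_Mapping.lookup m x\<^sub>2"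
        and "r = Poly_Mapping.lookup m x\<^sub>3" and "t = Poly_Mapping.lookup m x\<^sub>4"
      have "s \<le> q + t"
      proof (rule symbolic_power_keys[OF g1 f m])
        fix l n\<^sub>1 n\<^sub>2 n\<^sub>3 n\<^sub>4
        assume "\<forall>x\<in>{x\<^sub>2, x\<^sub>4}. Poly_Mapping.lookup l x = 0" "n\<^sub>1 + n\<^sub>2 + n\<^sub>3 + n\<^sub>4 = s"
          "dominates (m + l) n\<^sub>1 n\<^sub>2 n\<^sub>3 n\<^sub>4"
        then show ?thesis
          by (simp add: dominates_def lookup_add q_def t_def assms)
      qed
      moreover obtain \<alpha> \<beta> \<gamma> where "\<alpha> + \<beta> + \<gamma> = s" "\<alpha> \<le> p" "b * \<beta> + \<gamma> \<le> r" "\<gamma> \<le> t"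
      proof (rule symbolic_power_keys[OF g2 f m])
        fix l n\<^sub>1 n\<^sub>2 n\<^sub>3 n\<^sub>4
        assume l: "\<forall>x\<in>{x\<^sub>1, x\<^sub>3} \<union> (if b = 1 then {} else {x\<^sub>4}). Poly_Mapping.lookup l x = 0"
          and s: "n\<^sub>1 + n\<^sub>2 + n\<^sub>3 + n\<^sub>4 = s" and "dominates (m + l) n\<^sub>1 n\<^sub>2 n\<^sub>3 n\<^sub>4"
        then have n: "n\<^sub>1 + a * n\<^sub>4 \<le> p" "b * n\<^sub>2 + n\<^sub>3 \<le> r" "b \<noteq> 1 \<Longrightarrow> n\<^sub>3 + n\<^sub>4 \<le> t"
          by (auto simp: dominates_def lookup_add p_def r_def t_def a_def b_def assms)
        \<comment> \<open>With the bound at \<open>x\<^sub>2\<close> dropped, each edge leaving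
          \<open>x\<^sub>4\<close> may be traded for one leaving \<open>x\<^sub>1\<close>, which
          costs no more at \<open>x\<^sub>1\<close>. If \<open>b = 1\<close>, the bound at
          \<open>x\<^sub>4\<close> is missing too, and the edges leaving \<open>x\<^sub>3\<close>
          are counted in \<beta> instead.\<close>
        have "n\<^sub>1 + n\<^sub>4 \<le> p"
          using n(1) mult_le_mono1[OF ab(1), of n\<^sub>4] by linarith
        then show thesis
          using that[of "n\<^sub>1 + n\<^sub>4" n\<^sub>2 n\<^sub>3] that[of "n\<^sub>1 + n\<^sub>4" "n\<^sub>2 + n\<^sub>3" 0] s n(2,3)
          by (cases "b = 1") auto
      qed
      moreover obtain \<alpha>' \<beta>' \<gamma>' where "\<alpha>' + \<beta>' + \<gamma>' = s" "\<alpha>' \<le> r" "a * \<beta>' + \<gamma>' \<le> p" "\<gamma>' \<le> q"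
      proof (rule symbolic_power_keys[OF g3 f m])
        fix l n\<^sub>1 n\<^sub>2 n\<^sub>3 n\<^sub>4
        assume l: "\<forall>x\<in>{x\<^sub>1, x\<^sub>3} \<union> (if a = 1 then {} else {x\<^sub>2}). Poly_Mapping.lookup l x = 0"
          and s: "n\<^sub>1 + n\<^sub>2 + n\<^sub>3 + n\<^sub>4 = s" and "dominates (m + l) n\<^sub>1 n\<^sub>2 n\<^sub>3 n\<^sub>4"
        then have n: "n\<^sub>1 + a * n\<^sub>4 \<le> p" "b * n\<^sub>2 + n\<^sub>3 \<le> r" "a \<noteq> 1 \<Longrightarrow> n\<^sub>1 + n\<^sub>2 \<le> q"
          by (auto simp: dominates_def lookup_add p_def r_def q_def a_def b_def assms)
        have "n\<^sub>2 + n\<^sub>3 \<le> r"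
          using n(2) mult_le_mono1[OF ab(2), of n\<^sub>2] by linarith
        then show thesis
          using that[of "n\<^sub>2 + n\<^sub>3" n\<^sub>4 n\<^sub>1] that[of "n\<^sub>2 + n\<^sub>3" "n\<^sub>1 + n\<^sub>4" 0] s n(1,3)
          by (cases "a = 1") auto
      qed
      ultimately have "\<exists>n\<^sub>1 n\<^sub>2 n\<^sub>3 n\<^sub>4. n\<^sub>1 + n\<^sub>2 + n\<^sub>3 + n\<^sub>4 = s \<and> n\<^sub>1 + a * n\<^sub>4 \<le> p \<and> n\<^sub>1 + n\<^sub>2 \<le> q \<and>
          b * n\<^sub>2 + n\<^sub>3 \<le> r \<and> n\<^sub>3 + n\<^sub>4 \<le> t"
        using ab by (intro edge_multiplicities_of_localized_bounds)
      then show ?thesis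
        by (simp add: monomial_power_iff dominates_def assms a_def b_def p_def q_def r_def t_def)
    qed
    then show "f \<in> ideal_power I s"
      by (auto simp: edge_ideal_power monomial_ideal_def)
  qed
qed (rule ideal_power_subset_symbolic_power)

text \<open>The maximal ideal is not associated, so some variable is inverted at every associated
  prime. The monomial below lies in \<open>I ^ (w x\<^sub>2 + 1)\<close> after inverting any single variable,
  but not before.\<close>

lemma symbolic_power_neq:
  assumes w1: "w x\<^sub>1 \<ge> 2" and w2: "w x\<^sub>2 \<ge> 2" and w4: "w x\<^sub>4 = 1"
  shows "symbolic_power I (Suc (w x\<^sub>2)) \<noteq> ideal_power I (Suc (w x\<^sub>2))"
proof -
  define a b c where "a = w x\<^sub>1" and "b = w x\<^sub>2" and "c = w x\<^sub>3"
  have abc: "a \<ge> 2" "b \<ge> 2" "c \<ge> 1"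
    using assms weight_pos by (simp_all add: a_def b_def c_def)
  let ?m = "Poly_Mapping.single x\<^sub>1 1 + Poly_Mapping.single x\<^sub>2 b +
    (Poly_Mapping.single x\<^sub>3 (b * c) + Poly_Mapping.single x\<^sub>4 1)"
  have "\<not> dominates ?m n\<^sub>1 n\<^sub>2 n\<^sub>3 n\<^sub>4" if s: "n\<^sub>1 + n\<^sub>2 + n\<^sub>3 + n\<^sub>4 = Suc b" for n\<^sub>1 n\<^sub>2 n\<^sub>3 n\<^sub>4
  proof
    assume "dominates ?m n\<^sub>1 n\<^sub>2 n\<^sub>3 n\<^sub>4"
    then have n: "n\<^sub>1 + a * n\<^sub>4 \<le> 1" "b * n\<^sub>1 + n\<^sub>2 \<le> b" "c * n\<^sub>2 + n\<^sub>3 \<le> b * c" "n\<^sub>3 + n\<^sub>4 \<le> 1"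
      by (simp_all add: dominates_def lookup_vertex_simps w4 flip: a_def b_def c_def)
    \<comment> \<open>The exponent 1 at \<open>x\<^sub>1\<close> is below its weight, excluding the
      edge into it. Then \<open>n\<^sub>1 = 0\<close> forces \<open>n\<^sub>2 = b\<close> and
      \<open>n\<^sub>3 = 1\<close>, one too many at \<open>x\<^sub>3\<close>; and
      \<open>n\<^sub>1 = 1\<close> exhausts \<open>x\<^sub>2\<close>, leaving at most 2 edges in
      total, fewer than \<open>b + 1\<close>.\<close>
    have "n\<^sub>4 = 0"
      using n(1) abc(1) by (cases n\<^sub>4) auto
    consider "n\<^sub>1 = 0" | "n\<^sub>1 = 1"
      using n(1) by linarith
    then show False
    proof cases
      case 1
      then have "n\<^sub>2 = b" "n\<^sub>3 = 1"
        using s n \<open>n\<^sub>4 = 0\<close> by auto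
      then show False
        using n(3) by (simp add: mult.commute)
    next
      case 2
      then show False
        using s n \<open>n\<^sub>4 = 0\<close> abc(2) by simp
    qed
  qed
  then have "Poly_Mapping.single ?m 1 \<notin> ideal_power I (Suc b)"
    by (simp add: edge_ideal_power monomial_ideal_def monomial_power_iff
        del: monomial_power.simps)
  moreover have "Poly_Mapping.single ?m 1 \<in> symbolic_power I (Suc b)"
    unfolding symbolic_power_iff
  proof
    fix P assume "P \<in> associated_primes I"
    then obtain h where P: "is_prime_ideal P" "P = {r. r * h \<in> I}"
      unfolding associated_primes_def by blast
    have "h \<notin> I"
      using is_prime_ideal_D(2)[OF P(1)] P(2) by simp
    then obtain k where k: "k \<in> Poly_Mapping.keys h" "k \<notin> monomial_power edge_monomials 1"
      unfolding edge_ideal_monomial monomial_ideal_def by blast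
    \<comment> \<open>There are no socle monomials: if every variable moved \<open>k\<close> into
      \<open>I\<close>, then \<open>x\<^sub>4\<close> would give \<open>1 \<le> r\<close> or
      \<open>a \<le> p\<close>. Either makes \<open>t = 0\<close>, whence \<open>x\<^sub>1\<close>
      gives \<open>b \<le> q\<close>, and an edge monomial divides \<open>k\<close>, directly or
      after using \<open>x\<^sub>2\<close>. The variable found lies outside \<open>P\<close>,
      because the shifted term survives in \<open>h * var x\<close>.\<close>
    obtain x where x: "k + Poly_Mapping.single x 1 \<notin> monomial_power edge_monomials 1"
    proof (rule ccontr)
      assume "\<not> thesis"
      then have H: "k + Poly_Mapping.single x 1 \<in> monomial_power edge_monomials 1" for x
        using that by blast
      define p q r t where "p = Poly_Mapping.lookup k x\<^sub>1" and "q = Poly_Mapping.lookup k x\<^sub>2"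
        and "r = Poly_Mapping.lookup k x\<^sub>3" and "t = Poly_Mapping.lookup k x\<^sub>4"
      note defs = p_def q_def r_def t_def a_def b_def c_def
      have N: "\<not> (1 \<le> p \<and> b \<le> q)" "\<not> (1 \<le> q \<and> c \<le> r)" "\<not> (1 \<le> r \<and> 1 \<le> t)" "\<not> (1 \<le> t \<and> a \<le> p)"
        using k(2) unfolding monomial_power_1_iff w4 defs by blast+
      have H1: "b \<le> q \<or> 1 \<le> q \<and> c \<le> r \<or> 1 \<le> r \<and> 1 \<le> t \<or> 1 \<le> t \<and> a \<le> p + 1"
        using H[of x\<^sub>1] unfolding monomial_power_1_iff w4 defs by (simp add: lookup_vertex_simps)
      have H2: "1 \<le> p \<and> b \<le> q + 1 \<or> c \<le> r \<or> 1 \<le> r \<and> 1 \<le> t \<or> 1 \<le> t \<and> a \<le> p"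
        using H[of x\<^sub>2] unfolding monomial_power_1_iff w4 defs by (simp add: lookup_vertex_simps)
      have "1 \<le> p \<and> b \<le> q \<or> 1 \<le> q \<and> c \<le> r \<or> 1 \<le> r \<or> a \<le> p"
        using H[of x\<^sub>4] unfolding monomial_power_1_iff w4 defs by (simp add: lookup_vertex_simps)
      then consider "1 \<le> r" | "a \<le> p"
        using N by blast
      then show False
      proof cases
        case 1
        then have "t = 0"
          using N(3) by simp
        then have "b \<le> q"
          using H1 N by auto
        then have "p = 0" "1 \<le> q"
          using N(1) abc by simp_all
        then show False
          using H2 N(2) \<open>t = 0\<close> by simp
      next
        case 2
        then have "t = 0"
          using N(4) by simp
        then have "b \<le> q"
          using H1 N(2) by auto
        then show False
          using N(1) 2 abc by simp
      qed
    qed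
    have "h * var x \<notin> I"
      using k(1) x unfolding edge_ideal_monomial
      by (auto simp: monomial_ideal_def var_def keys_times_single simp del: monomial_power.simps)
    then have "var x ^ (a + b) \<notin> P"
      by (intro is_prime_ideal_power_notin[OF P(1)]) (simp add: P(2) mult.commute)
    \<comment> \<open>The exponent \<open>a + b\<close> covers the shortage at whichever vertex is
      inverted. For \<open>x\<^sub>1\<close>, \<open>x\<^sub>2\<close>, \<open>x\<^sub>3\<close> the
      product uses the second edge \<open>b\<close> times and the fourth, first or third edge once;
      for \<open>x\<^sub>4\<close> it uses the first edge once and the third \<open>b\<close>
      times.\<close>
    moreover have "\<forall>x. Poly_Mapping.single x (a + b) + ?m \<in> monomial_power edge_monomials (Suc b)"
      unfolding all_vertices_iff
    proof (intro conjI)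
      have "b \<le> b * c"
        using abc by simp
      show "Poly_Mapping.single x\<^sub>1 (a + b) + ?m \<in> monomial_power edge_monomials (Suc b)"
        unfolding monomial_power_iff
        by - (rule exI[of _ 0], rule exI[of _ b], rule exI[of _ 0], rule exI[of _ 1],
          simp add: dominates_def lookup_vertex_simps w4 flip: a_def b_def c_def)
      show "Poly_Mapping.single x\<^sub>2 (a + b) + ?m \<in> monomial_power edge_monomials (Suc b)"
        unfolding monomial_power_iff
        by - (rule exI[of _ 1], rule exI[of _ b], rule exI[of _ 0], rule exI[of _ 0],
          simp add: dominates_def lookup_vertex_simps w4 flip: a_def b_def c_def)
      show "Poly_Mapping.single x\<^sub>3 (a + b) + ?m \<in> monomial_power edge_monomials (Suc b)"
        unfolding monomial_power_iff using abc
        by - (rule exI[of _ 0], rule exI[of _ b], rule exI[of _ 1], rule exI[of _ 0],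
          simp add: dominates_def lookup_vertex_simps w4 flip: a_def b_def c_def)
      show "Poly_Mapping.single x\<^sub>4 (a + b) + ?m \<in> monomial_power edge_monomials (Suc b)"
        unfolding monomial_power_iff using \<open>b \<le> b * c\<close>
        by - (rule exI[of _ 1], rule exI[of _ 0], rule exI[of _ b], rule exI[of _ 0],
          simp add: dominates_def lookup_vertex_simps w4 flip: a_def b_def c_def)
    qed
    then have "var x ^ (a + b) * Poly_Mapping.single ?m 1 \<in> ideal_power I (Suc b)"
      by (simp add: var_power mult_single edge_ideal_power monomial_ideal_def
          del: monomial_power.simps)
    ultimately show "\<exists>u. u \<notin> P \<and> u * Poly_Mapping.single ?m 1 \<in> ideal_power I (Suc b)"
      by blast
  qed
  ultimately show ?thesis
    unfolding b_def by metis
qed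

end

end

section \<open>Rotations of the cycle and the three weight conditions\<close>

theorem proposition3p20:
  fixes E :: "('v::{finite,linorder} \<times> 'v) set"
    and w :: "'v \<Rightarrow> nat"
    and x\<^sub>1 x\<^sub>2 x\<^sub>3 x\<^sub>4 :: 'v
    and I :: "('v, 'k::field) mpoly set"
  assumes "weighted_oriented_graph E w"
    and "naturally_oriented_cycle E [x\<^sub>1, x\<^sub>2, x\<^sub>3, x\<^sub>4]"
    and "nontrivial_vertices w \<noteq> {}"
    and "I = edge_ideal E w"
  shows "(\<forall>s\<ge>2. symbolic_power I s = ideal_power I s) \<longleftrightarrow>
           nontrivial_vertices w = UNIV \<or>
           card (nontrivial_vertices w) = 1 \<or>
           (\<exists>u v. u \<noteq> v \<and> nontrivial_vertices w = {u, v} \<and> (u, v) \<notin> E \<and> (v, u) \<notin> E)"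
    (is "?L \<longleftrightarrow> ?R")
proof -
  have distinct: "distinct [x\<^sub>1, x\<^sub>2, x\<^sub>3, x\<^sub>4]" and vertices: "UNIV = {x\<^sub>1, x\<^sub>2, x\<^sub>3, x\<^sub>4}"
    using assms(2) by (auto simp: naturally_oriented_cycle_def)
  have "E = (\<lambda>i. ([x\<^sub>1, x\<^sub>2, x\<^sub>3, x\<^sub>4] ! i, [x\<^sub>1, x\<^sub>2, x\<^sub>3, x\<^sub>4] ! (Suc i mod 4))) ` {..<4}"
    using assms(2) by (auto simp: naturally_oriented_cycle_def)
  moreover have "{..<4::nat} = {0, 1, 2, 3}"
    by auto
  ultimately have E: "E = {(x\<^sub>1, x\<^sub>2), (x\<^sub>2, x\<^sub>3), (x\<^sub>3, x\<^sub>4), (x\<^sub>4, x\<^sub>1)}"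
    by simp
  have pos: "w v \<ge> 1" for v
    using assms(1) by (rule weighted_oriented_graph.weight_pos)
  interpret A: weighted_four_cycle w x\<^sub>1 x\<^sub>2 x\<^sub>3 x\<^sub>4
    using distinct vertices pos by unfold_locales auto
  interpret B: weighted_four_cycle w x\<^sub>2 x\<^sub>3 x\<^sub>4 x\<^sub>1
    using distinct vertices pos by unfold_locales auto
  interpret C: weighted_four_cycle w x\<^sub>3 x\<^sub>4 x\<^sub>1 x\<^sub>2
    using distinct vertices pos by unfold_locales auto
  interpret D: weighted_four_cycle w x\<^sub>4 x\<^sub>1 x\<^sub>2 x\<^sub>3
    using distinct vertices pos by unfold_locales auto
  have IA: "I = ideal_gen ((\<lambda>g. Poly_Mapping.single g 1) ` A.edge_monomials)"
    unfolding assms(4) by (rule A.edge_ideal_eq) (simp add: E)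
  have IB: "I = ideal_gen ((\<lambda>g. Poly_Mapping.single g 1) ` B.edge_monomials)"
    unfolding assms(4) by (rule B.edge_ideal_eq) (auto simp: E)
  have IC: "I = ideal_gen ((\<lambda>g. Poly_Mapping.single g 1) ` C.edge_monomials)"
    unfolding assms(4) by (rule C.edge_ideal_eq) (auto simp: E)
  have ID: "I = ideal_gen ((\<lambda>g. Poly_Mapping.single g 1) ` D.edge_monomials)"
    unfolding assms(4) by (rule D.edge_ideal_eq) (auto simp: E)
  have ge2: "w v \<ge> 2" if "w v \<noteq> 1" for v
    using pos[of v] that by linarith
  \<comment> \<open>The three conditions in terms of labels: all weights are non-trivial, or one of
    the two opposite pairs has only trivial weights.\<close>
  let ?M = "(\<forall>v. w v \<noteq> 1) \<or> (w x\<^sub>2 = 1 \<and> w x\<^sub>4 = 1) \<or> (w x\<^sub>1 = 1 \<and> w x\<^sub>3 = 1)"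
  have "?L \<longleftrightarrow> ?M"
  proof
    assume ?L
    then have L: "symbolic_power I (Suc (w v)) = ideal_power I (Suc (w v))" for v
      using pos[of v] by simp
    show ?M
      \<comment> \<open>If \<open>?M\<close> fails, both opposite pairs contain a non-trivial
        vertex, so two consecutive vertices are non-trivial, while some vertex is trivial. The start
        of such a run gives, in some rotation, a trivial vertex followed by two non-trivial
        ones.\<close>
      using A.symbolic_power_neq[OF IA] B.symbolic_power_neq[OF IB]
        C.symbolic_power_neq[OF IC] D.symbolic_power_neq[OF ID] ge2
      unfolding L A.all_vertices_iff by blast
  next
    assume ?M
    then show ?L
      using A.symbolic_power_eq_all_nontrivial[OF IA] A.symbolic_power_eq_alternating[OF IA]
        B.symbolic_power_eq_alternating[OF IB] ge2 by blast
  qed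
  also have "?M \<longleftrightarrow> ?R"
  proof
    assume ?M
    moreover have "nontrivial_vertices w \<subseteq> S \<longleftrightarrow> (\<forall>v. w v \<noteq> 1 \<longrightarrow> v \<in> S)" for S
      by (auto simp: nontrivial_vertices_def)
    \<comment> \<open>Conditions (2) and (3) together describe the nonempty subsets of an opposite
      pair.\<close>
    ultimately consider "\<forall>v. w v \<noteq> 1" | "nontrivial_vertices w \<subseteq> {x\<^sub>1, x\<^sub>3}" | "nontrivial_vertices w \<subseteq> {x\<^sub>2, x\<^sub>4}"
      unfolding A.all_vertices_iff by auto
    then show ?R
    proof cases
      case 1
      then show ?thesis
        by (simp add: nontrivial_vertices_def)
    next
      case 2
      then consider "nontrivial_vertices w = {x\<^sub>1}" | "nontrivial_vertices w = {x\<^sub>3}"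
        | "nontrivial_vertices w = {x\<^sub>1, x\<^sub>3}"
        using assms(3) by blast
      then show ?thesis
      proof cases
        case 3
        moreover have "x\<^sub>1 \<noteq> x\<^sub>3" "(x\<^sub>1, x\<^sub>3) \<notin> E" "(x\<^sub>3, x\<^sub>1) \<notin> E"
          using A.neq by (auto simp: E)
        ultimately show ?thesis
          by blast
      qed simp_all
    next
      case 3
      then consider "nontrivial_vertices w = {x\<^sub>2}" | "nontrivial_vertices w = {x\<^sub>4}"
        | "nontrivial_vertices w = {x\<^sub>2, x\<^sub>4}"
        using assms(3) by blast
      then show ?thesis
      proof cases
        case 3
        moreover have "x\<^sub>2 \<noteq> x\<^sub>4" "(x\<^sub>2, x\<^sub>4) \<notin> E" "(x\<^sub>4, x\<^sub>2) \<notin> E"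
          using A.neq by (auto simp: E)
        ultimately show ?thesis
          by blast
      qed simp_all
    qed
  next
    assume ?R
    then consider "nontrivial_vertices w = UNIV" | v where "nontrivial_vertices w = {v}"
      | u v where "u \<noteq> v" "nontrivial_vertices w = {u, v}" "(u, v) \<notin> E" "(v, u) \<notin> E"
      by (auto simp: card_1_singleton_iff)
    then show ?M
    proof cases
      case 1
      then show ?thesis
        by (auto simp: nontrivial_vertices_def)
    next
      case (2 v)
      then have "w x = 1 \<longleftrightarrow> x \<noteq> v" for x
        by (auto simp: nontrivial_vertices_def)
      then show ?thesis
        using A.neq by metis
    next
      case (3 u v)
      have w: "w x = 1 \<longleftrightarrow> x \<noteq> u \<and> x \<noteq> v" for x
        using 3(2) by (auto simp: nontrivial_vertices_def)
      have "u \<in> {x\<^sub>1, x\<^sub>2, x\<^sub>3, x\<^sub>4}" "v \<in> {x\<^sub>1, x\<^sub>2, x\<^sub>3, x\<^sub>4}"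
        using vertices by auto
      then have "{u, v} = {x\<^sub>1, x\<^sub>3} \<or> {u, v} = {x\<^sub>2, x\<^sub>4}"
        using 3(1,3,4) unfolding E by blast
      then show ?thesis
        using A.neq unfolding w doubleton_eq_iff by metis
    qed
  qed
  finally show ?thesis .
qed

end
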